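(* Let $M$ be a smooth manifold with an affine connection $\nabla$, let $\mathfrak{X}_M=\Gamma(TM)$ be the real vector space of smooth vector fields on $M$, and set $X\rhd Y:=\nabla_XY$. Then the connection algebra $(\mathfrak{X}_M,\rhd)$ is a Lie admissible triple algebra if and only if $(M,\nabla)$ is a locally symmetric space.
   Context: In an algebra with product $\rhd$ put $\mathrm{ass}(x,y,z)=x\rhd(y\rhd z)-(x\rhd y)\rhd z$ and $[x,y,z]=\mathrm{ass}(x,y,z)-\mathrm{ass}(y,x,z)$. The algebra is a Lie admissible triple (LAT) algebra if for all elements $[x,y,z]+[y,z,x]+[z,x,y]=0$ and $w\rhd[x,y,z]-[w\rhd x,y,z]-[x,w\rhd y,z]-[x,y,w\rhd z]=0$. The torsion and curvature of $\nabla$ are $T(X,Y)=\nabla_XY-\nabla_YX-[X,Y]_J$ and $R(X,Y)Z=\nabla_X\nabla_YZ-\nabla_Y\nabla_XZ-\nabla_{[X,Y]_J}Z$, where $[\cdot,\cdot]_J$ is the Jacobi–Lie bracket of vector fields. $(M,\nabla)$ being a locally symmetric space (with its canonical connection $\nabla$) means that $T=0$ and $\nabla R=0$. *)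

theory Defs
  imports "HOL-Analysis.Analysis" "HOL-Library.Function_Algebras"
begin

section \<open>Lie admissible triple algebras\<close>

text \<open>An algebra is given by its carrier \<open>A\<close>, a linear subspace of an ambient type, and its product \<open>m\<close>.\<close>

definition ass :: "('v::ab_group_add \<Rightarrow> 'v \<Rightarrow> 'v) \<Rightarrow> 'v \<Rightarrow> 'v \<Rightarrow> 'v \<Rightarrow> 'v" where
  "ass m x y z = m x (m y z) - m (m x y) z"

definition triple_bracket :: "('v::ab_group_add \<Rightarrow> 'v \<Rightarrow> 'v) \<Rightarrow> 'v \<Rightarrow> 'v \<Rightarrow> 'v \<Rightarrow> 'v" where
  "triple_bracket m x y z = ass m x y z - ass m y x z"

definition lat_algebra :: "'v::ab_group_add set \<Rightarrow> ('v \<Rightarrow> 'v \<Rightarrow> 'v) \<Rightarrow> bool" where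
  "lat_algebra A m \<longleftrightarrow>
     (\<forall>x\<in>A. \<forall>y\<in>A. \<forall>z\<in>A.
        triple_bracket m x y z + triple_bracket m y z x + triple_bracket m z x y = 0) \<and>
     (\<forall>w\<in>A. \<forall>x\<in>A. \<forall>y\<in>A. \<forall>z\<in>A.
        m w (triple_bracket m x y z) - triple_bracket m (m w x) y z
          - triple_bracket m x (m w y) z - triple_bracket m x y (m w z) = 0)"

section \<open>Smooth manifolds\<close>

text \<open>
  \<open>\<real>\<^sup>n\<close> is \<^term>\<open>Euclidean_space n\<close>: the sequences vanishing from index \<open>n\<close> on, with the product
  topology. The dimension is thus a number, and \<open>n = 0\<close> is included. \<open>C\<^sup>k\<close> functions on an open
  subset of it are defined by iterated partial derivatives; the witness \<open>f'\<close> is the \<open>i\<close>-th partial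
  derivative on \<open>V\<close>, and its values off \<open>V\<close> are irrelevant.
\<close>

fun C_on :: "nat \<Rightarrow> nat \<Rightarrow> (nat \<Rightarrow> real) set \<Rightarrow> ((nat \<Rightarrow> real) \<Rightarrow> real) \<Rightarrow> bool" where
  "C_on n 0 V f \<longleftrightarrow> continuous_on V f"
| "C_on n (Suc k) V f \<longleftrightarrow> continuous_on V f \<and>
     (\<forall>i<n. \<exists>f'. (\<forall>x\<in>V. ((\<lambda>t. f (x(i := t))) has_real_derivative f' x) (at (x i))) \<and>
                 C_on n k V f')"

definition smooth_on :: "nat \<Rightarrow> (nat \<Rightarrow> real) set \<Rightarrow> ((nat \<Rightarrow> real) \<Rightarrow> real) \<Rightarrow> bool" where
  "smooth_on n V f \<longleftrightarrow> (\<forall>k. C_on n k V f)"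

type_synonym 'a chart = "'a set \<times> ('a \<Rightarrow> nat \<Rightarrow> real)"

definition is_chart :: "nat \<Rightarrow> 'a::topological_space chart \<Rightarrow> bool" where
  "is_chart n = (\<lambda>(U, \<phi>). open U \<and> openin (Euclidean_space n) (\<phi> ` U) \<and>
     homeomorphism U (\<phi> ` U) \<phi> (inv_into U \<phi>))"

definition smooth_transition :: "nat \<Rightarrow> 'a chart \<Rightarrow> 'a chart \<Rightarrow> bool" where
  "smooth_transition n = (\<lambda>(U, \<phi>) (V, \<psi>).
     \<forall>i<n. smooth_on n (\<phi> ` (U \<inter> V)) (\<lambda>x. \<psi> (inv_into U \<phi> x) i))"

text \<open>
  The underlying space of the manifold is a type; being Hausdorff and second countable are class
  constraints on it. The atlas need not be maximal.
\<close>

definition smooth_manifold ::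
    "nat \<Rightarrow> 'a::{t2_space,second_countable_topology} chart set \<Rightarrow> bool" where
  "smooth_manifold n \<A> \<longleftrightarrow>
     (\<forall>c\<in>\<A>. is_chart n c) \<and>
     (\<Union>(fst ` \<A>)) = UNIV \<and>
     (\<forall>c\<in>\<A>. \<forall>d\<in>\<A>. smooth_transition n c d)"

definition smooth_functions :: "nat \<Rightarrow> 'a chart set \<Rightarrow> ('a \<Rightarrow> real) set" where
  "smooth_functions n \<A> = {f. \<forall>(U, \<phi>)\<in>\<A>. smooth_on n (\<phi> ` U) (\<lambda>x. f (inv_into U \<phi> x))}"

section \<open>Vector fields\<close>

text \<open>
  A tangent vector at \<open>p\<close> is a derivation at \<open>p\<close> of the algebra of smooth functions. The first
  clause extends it by \<open>0\<close> to all functions, so that tangent vectors that agree on smooth functions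
  are equal and the pointwise operations on the function type are those of the tangent space.
\<close>

definition tangent_space :: "nat \<Rightarrow> 'a chart set \<Rightarrow> 'a \<Rightarrow> (('a \<Rightarrow> real) \<Rightarrow> real) set" where
  "tangent_space n \<A> p = {v.
     (\<forall>f. f \<notin> smooth_functions n \<A> \<longrightarrow> v f = 0) \<and>
     (\<forall>f\<in>smooth_functions n \<A>. \<forall>g\<in>smooth_functions n \<A>. v (f + g) = v f + v g) \<and>
     (\<forall>f\<in>smooth_functions n \<A>. \<forall>c. v (\<lambda>q. c * f q) = c * v f) \<and>
     (\<forall>f\<in>smooth_functions n \<A>. \<forall>g\<in>smooth_functions n \<A>. v (f * g) = v f * g p + f p * v g)}"

type_synonym 'a vector_field = "'a \<Rightarrow> ('a \<Rightarrow> real) \<Rightarrow> real"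

definition apply_field :: "'a vector_field \<Rightarrow> ('a \<Rightarrow> real) \<Rightarrow> 'a \<Rightarrow> real" where
  "apply_field X f = (\<lambda>p. X p f)"

text \<open>
  Smoothness of a section of the tangent bundle as in Kobayashi--Nomizu and O'Neill: \<open>X f\<close> is smooth
  for every smooth function \<open>f\<close>.
\<close>

definition vector_fields :: "nat \<Rightarrow> 'a chart set \<Rightarrow> 'a vector_field set" where
  "vector_fields n \<A> = {X. (\<forall>p. X p \<in> tangent_space n \<A> p) \<and>
     (\<forall>f\<in>smooth_functions n \<A>. apply_field X f \<in> smooth_functions n \<A>)}"

definition scale_field :: "('a \<Rightarrow> real) \<Rightarrow> 'a vector_field \<Rightarrow> 'a vector_field" where
  "scale_field f X = (\<lambda>p h. f p * X p h)"

definition jacobi_lie :: "'a vector_field \<Rightarrow> 'a vector_field \<Rightarrow> 'a vector_field" where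
  "jacobi_lie X Y = (\<lambda>p f. X p (apply_field Y f) - Y p (apply_field X f))"

section \<open>Affine connections\<close>

definition affine_connection ::
    "nat \<Rightarrow> 'a chart set \<Rightarrow> ('a vector_field \<Rightarrow> 'a vector_field \<Rightarrow> 'a vector_field) \<Rightarrow> bool" where
  "affine_connection n \<A> D \<longleftrightarrow>
     (\<forall>X\<in>vector_fields n \<A>. \<forall>Y\<in>vector_fields n \<A>. D X Y \<in> vector_fields n \<A>) \<and>
     (\<forall>X\<in>vector_fields n \<A>. \<forall>Y\<in>vector_fields n \<A>. \<forall>Z\<in>vector_fields n \<A>.
        D (X + Y) Z = D X Z + D Y Z \<and> D X (Y + Z) = D X Y + D X Z) \<and>
     (\<forall>X\<in>vector_fields n \<A>. \<forall>Y\<in>vector_fields n \<A>. \<forall>c.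
        D X (scale_field (\<lambda>_. c) Y) = scale_field (\<lambda>_. c) (D X Y)) \<and>
     (\<forall>X\<in>vector_fields n \<A>. \<forall>Y\<in>vector_fields n \<A>. \<forall>f\<in>smooth_functions n \<A>.
        D (scale_field f X) Y = scale_field f (D X Y) \<and>
        D X (scale_field f Y) = scale_field (apply_field X f) Y + scale_field f (D X Y))"

definition torsion ::
    "('a vector_field \<Rightarrow> 'a vector_field \<Rightarrow> 'a vector_field) \<Rightarrow>
     'a vector_field \<Rightarrow> 'a vector_field \<Rightarrow> 'a vector_field" where
  "torsion D X Y = D X Y - D Y X - jacobi_lie X Y"

definition curvature ::
    "('a vector_field \<Rightarrow> 'a vector_field \<Rightarrow> 'a vector_field) \<Rightarrow>
     'a vector_field \<Rightarrow> 'a vector_field \<Rightarrow> 'a vector_field \<Rightarrow> 'a vector_field" where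
  "curvature D X Y Z = D X (D Y Z) - D Y (D X Z) - D (jacobi_lie X Y) Z"

text \<open>\<open>(\<nabla>\<^sub>W R)(X, Y) Z\<close>, the covariant derivative of the curvature as a tensor field\<close>

definition nabla_curvature ::
    "('a vector_field \<Rightarrow> 'a vector_field \<Rightarrow> 'a vector_field) \<Rightarrow>
     'a vector_field \<Rightarrow> 'a vector_field \<Rightarrow> 'a vector_field \<Rightarrow> 'a vector_field \<Rightarrow> 'a vector_field" where
  "nabla_curvature D W X Y Z =
     D W (curvature D X Y Z) - curvature D (D W X) Y Z
       - curvature D X (D W Y) Z - curvature D X Y (D W Z)"

definition locally_symmetric ::
    "nat \<Rightarrow> 'a chart set \<Rightarrow> ('a vector_field \<Rightarrow> 'a vector_field \<Rightarrow> 'a vector_field) \<Rightarrow> bool" where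
  "locally_symmetric n \<A> D \<longleftrightarrow>
     (\<forall>X\<in>vector_fields n \<A>. \<forall>Y\<in>vector_fields n \<A>. torsion D X Y = 0) \<and>
     (\<forall>W\<in>vector_fields n \<A>. \<forall>X\<in>vector_fields n \<A>. \<forall>Y\<in>vector_fields n \<A>. \<forall>Z\<in>vector_fields n \<A>.
        nabla_curvature D W X Y Z = 0)"

end

(* Writing T for the torsion, the triple bracket of the connection algebra satisfies
   [X,Y,Z] = R(X,Y)Z - \<nabla>_{T(X,Y)} Z.  It is linear over smooth functions in X and Y, and
   [X,Y,fZ] = f [X,Y,Z] - (T(X,Y) f) Z.  Hence the cyclic identity for X, Y, fZ forces
   (T(X,Y) f) Z = 0, and Z = T(X,Y) gives T = 0.  Once T = 0 the triple bracket is the curvature: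
   the cyclic identity is the first Bianchi identity and the other identity is \<nabla>R = 0. *)

theory Submission
  imports Defs
begin

section \<open>Smooth functions\<close>

lemma C_on_continuous_on: "C_on n k V f \<Longrightarrow> continuous_on V f"
  by (cases k) auto

lemma C_on_SucE:
  assumes "C_on n (Suc k) V f" "i < n"
  obtains f' where "\<forall>x\<in>V. ((\<lambda>t. f (x(i := t))) has_real_derivative f' x) (at (x i))"
    "C_on n k V f'"
  using assms by auto

text \<open>Needed for the product rule, where undifferentiated factors of order
  \<open>Suc k\<close> stand beside partial derivatives of order \<open>k\<close>.\<close>

lemma C_on_SucD: "C_on n (Suc k) V f \<Longrightarrow> C_on n k V f"
proof (induction k arbitrary: f)
  case 0
  then show ?case by simp
next
  case (Suc k)
  have "\<exists>f'. (\<forall>x\<in>V. ((\<lambda>t. f (x(i := t))) has_real_derivative f' x) (at (x i))) \<and> C_on n k V f'"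
    if i: "i < n" for i
  proof -
    obtain f' where f': "\<forall>x\<in>V. ((\<lambda>t. f (x(i := t))) has_real_derivative f' x) (at (x i))"
      "C_on n (Suc k) V f'"
      by (rule C_on_SucE[OF Suc.prems i])
    show ?thesis
      by (rule exI[of _ f'], rule conjI[OF f'(1) Suc.IH[OF f'(2)]])
  qed
  then show ?case
    using C_on_continuous_on[OF Suc.prems] by simp
qed

lemma C_on_const: "C_on n k V (\<lambda>_. c)"
proof (induction k arbitrary: c)
  case (Suc k)
  then show ?case by (auto intro!: exI[of _ "\<lambda>_. 0"])
qed simp

lemma C_on_add:
  assumes "C_on n k V f" "C_on n k V g"
  shows "C_on n k V (\<lambda>x. f x + g x)"
  using assms
proof (induction k arbitrary: f g)
  case (Suc k)
  have "\<exists>h. (\<forall>x\<in>V. ((\<lambda>t. f (x(i := t)) + g (x(i := t))) has_real_derivative h x) (at (x i)))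
            \<and> C_on n k V h" if i: "i < n" for i
  proof -
    obtain f' where f': "\<forall>x\<in>V. ((\<lambda>t. f (x(i := t))) has_real_derivative f' x) (at (x i))"
      "C_on n k V f'"
      by (rule C_on_SucE[OF Suc.prems(1) i])
    obtain g' where g': "\<forall>x\<in>V. ((\<lambda>t. g (x(i := t))) has_real_derivative g' x) (at (x i))"
      "C_on n k V g'"
      by (rule C_on_SucE[OF Suc.prems(2) i])
    have "((\<lambda>t. f (x(i := t)) + g (x(i := t))) has_real_derivative f' x + g' x) (at (x i))"
      if "x \<in> V" for x
      using DERIV_add[OF f'(1)[rule_format, OF that] g'(1)[rule_format, OF that]] .
    moreover have "C_on n k V (\<lambda>x. f' x + g' x)"
      using f'(2) g'(2) by (rule Suc.IH)
    ultimately show ?thesis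
      by (intro exI[of _ "\<lambda>x. f' x + g' x"] conjI ballI)
  qed
  moreover have "continuous_on V (\<lambda>x. f x + g x)"
    using Suc.prems by (intro continuous_on_add C_on_continuous_on)
  ultimately show ?case
    by simp
qed (simp add: continuous_on_add)

text \<open>By Leibniz each partial derivative is \<open>f' x * g x + f x * g' x\<close>. The
  induction generalises both factors because its hypothesis is applied to the pairs
  \<open>f'\<close>, \<open>g\<close> and \<open>f\<close>, \<open>g'\<close>.\<close>

lemma C_on_mult:
  assumes "C_on n k V f" "C_on n k V g"
  shows "C_on n k V (\<lambda>x. f x * g x)"
  using assms
proof (induction k arbitrary: f g)
  case (Suc k)
  have "\<exists>h. (\<forall>x\<in>V. ((\<lambda>t. f (x(i := t)) * g (x(i := t))) has_real_derivative h x) (at (x i)))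
            \<and> C_on n k V h" if i: "i < n" for i
  proof -
    obtain f' where f': "\<forall>x\<in>V. ((\<lambda>t. f (x(i := t))) has_real_derivative f' x) (at (x i))"
      "C_on n k V f'"
      by (rule C_on_SucE[OF Suc.prems(1) i])
    obtain g' where g': "\<forall>x\<in>V. ((\<lambda>t. g (x(i := t))) has_real_derivative g' x) (at (x i))"
      "C_on n k V g'"
      by (rule C_on_SucE[OF Suc.prems(2) i])
    have "((\<lambda>t. f (x(i := t)) * g (x(i := t))) has_real_derivative f' x * g x + f x * g' x)
            (at (x i))" if "x \<in> V" for x
      using DERIV_mult[OF f'(1)[rule_format, OF that] g'(1)[rule_format, OF that]]
      by (simp add: algebra_simps)
    moreover have "C_on n k V (\<lambda>x. f' x * g x + f x * g' x)"
      by (intro C_on_add Suc.IH f'(2) g'(2) Suc.prems[THEN C_on_SucD])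
    ultimately show ?thesis
      by (intro exI[of _ "\<lambda>x. f' x * g x + f x * g' x"] conjI ballI)
  qed
  moreover have "continuous_on V (\<lambda>x. f x * g x)"
    using Suc.prems by (intro continuous_on_mult C_on_continuous_on)
  ultimately show ?case
    by simp
qed (simp add: continuous_on_mult)

section \<open>The algebra of smooth functions on the manifold\<close>

lemma smooth_functions_const: "(\<lambda>_. c) \<in> smooth_functions n \<A>"
  by (auto simp: smooth_functions_def smooth_on_def intro: C_on_const)

lemma smooth_functions_add:
  "f \<in> smooth_functions n \<A> \<Longrightarrow> g \<in> smooth_functions n \<A> \<Longrightarrow> f + g \<in> smooth_functions n \<A>"
  by (simp add: smooth_functions_def smooth_on_def C_on_add split_beta)

lemma smooth_functions_mult:
  "f \<in> smooth_functions n \<A> \<Longrightarrow> g \<in> smooth_functions n \<A> \<Longrightarrow> f * g \<in> smooth_functions n \<A>"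
  by (simp add: smooth_functions_def smooth_on_def C_on_mult split_beta)

lemma smooth_functions_cmult:
  "f \<in> smooth_functions n \<A> \<Longrightarrow> (\<lambda>q. c * f q) \<in> smooth_functions n \<A>"
  using smooth_functions_mult[OF smooth_functions_const, of f n \<A> c] by (simp add: times_fun_def)

lemma smooth_functions_diff:
  assumes "f \<in> smooth_functions n \<A>" "g \<in> smooth_functions n \<A>"
  shows "f - g \<in> smooth_functions n \<A>"
proof -
  have "f - g = f + (\<lambda>q. (-1) * g q)"
    by (simp add: fun_eq_iff)
  then show ?thesis
    using assms by (simp only: smooth_functions_add smooth_functions_cmult)
qed

section \<open>The Lie algebra of vector fields\<close>

text \<open>This convention lets equalities of vector fields be checked on smooth functions
  alone.\<close>

lemma field_nonsmooth:
  "X \<in> vector_fields n \<A> \<Longrightarrow> f \<notin> smooth_functions n \<A> \<Longrightarrow> X p f = 0"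
  by (auto simp: vector_fields_def tangent_space_def)

lemma field_add:
  "X \<in> vector_fields n \<A> \<Longrightarrow> f \<in> smooth_functions n \<A> \<Longrightarrow> g \<in> smooth_functions n \<A> \<Longrightarrow>
    X p (f + g) = X p f + X p g"
  by (auto simp: vector_fields_def tangent_space_def)

lemma field_cmult:
  "X \<in> vector_fields n \<A> \<Longrightarrow> f \<in> smooth_functions n \<A> \<Longrightarrow> X p (\<lambda>q. c * f q) = c * X p f"
  by (auto simp: vector_fields_def tangent_space_def)

lemma field_mult:
  "X \<in> vector_fields n \<A> \<Longrightarrow> f \<in> smooth_functions n \<A> \<Longrightarrow> g \<in> smooth_functions n \<A> \<Longrightarrow>
    X p (f * g) = X p f * g p + f p * X p g"
  by (auto simp: vector_fields_def tangent_space_def)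

lemma field_diff:
  assumes "X \<in> vector_fields n \<A>" "f \<in> smooth_functions n \<A>" "g \<in> smooth_functions n \<A>"
  shows "X p (f - g) = X p f - X p g"
  using field_add[OF assms(1) smooth_functions_diff[OF assms(2,3)] assms(3), of p] by simp

text \<open>Homogeneity with factor 0. It makes a Lie bracket vanish on a nonsmooth
  \<open>f\<close>, where the inner field already returns the zero function.\<close>

lemma field_zero: "X \<in> vector_fields n \<A> \<Longrightarrow> X p 0 = 0"
  using field_cmult[OF _ smooth_functions_const, of X n \<A> p 0 0] by (simp add: zero_fun_def)

lemma apply_field_smooth:
  "X \<in> vector_fields n \<A> \<Longrightarrow> f \<in> smooth_functions n \<A> \<Longrightarrow> apply_field X f \<in> smooth_functions n \<A>"
  by (auto simp: vector_fields_def)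

lemma apply_field_nonsmooth:
  "X \<in> vector_fields n \<A> \<Longrightarrow> f \<notin> smooth_functions n \<A> \<Longrightarrow> apply_field X f = 0"
  by (auto simp: apply_field_def fun_eq_iff field_nonsmooth)

lemma vector_fieldsI:
  assumes "\<And>p f. f \<notin> smooth_functions n \<A> \<Longrightarrow> X p f = 0"
    and "\<And>p f g. f \<in> smooth_functions n \<A> \<Longrightarrow> g \<in> smooth_functions n \<A> \<Longrightarrow>
      X p (f + g) = X p f + X p g"
    and "\<And>p f c. f \<in> smooth_functions n \<A> \<Longrightarrow> X p (\<lambda>q. c * f q) = c * X p f"
    and "\<And>p f g. f \<in> smooth_functions n \<A> \<Longrightarrow> g \<in> smooth_functions n \<A> \<Longrightarrow>
      X p (f * g) = X p f * g p + f p * X p g"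
    and "\<And>f. f \<in> smooth_functions n \<A> \<Longrightarrow> apply_field X f \<in> smooth_functions n \<A>"
  shows "X \<in> vector_fields n \<A>"
  using assms by (simp add: vector_fields_def tangent_space_def)

lemma vector_fields_diff:
  assumes X: "X \<in> vector_fields n \<A>" and Y: "Y \<in> vector_fields n \<A>"
  shows "X - Y \<in> vector_fields n \<A>"
proof (rule vector_fieldsI)
  fix f assume f: "f \<in> smooth_functions n \<A>"
  have "apply_field (X - Y) f = apply_field X f - apply_field Y f"
    by (simp add: apply_field_def fun_eq_iff)
  then show "apply_field (X - Y) f \<in> smooth_functions n \<A>"
    using X Y f by (simp add: smooth_functions_diff apply_field_smooth)
qed (use X Y in \<open>simp_all add: field_nonsmooth field_add field_cmult field_mult algebra_simps\<close>)

lemma vector_fields_scale: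
  assumes X: "X \<in> vector_fields n \<A>" and f: "f \<in> smooth_functions n \<A>"
  shows "scale_field f X \<in> vector_fields n \<A>"
proof (rule vector_fieldsI)
  fix g assume g: "g \<in> smooth_functions n \<A>"
  have "apply_field (scale_field f X) g = f * apply_field X g"
    by (simp add: apply_field_def scale_field_def fun_eq_iff)
  then show "apply_field (scale_field f X) g \<in> smooth_functions n \<A>"
    using X f g by (simp add: smooth_functions_mult apply_field_smooth)
qed (use X in \<open>simp_all add: scale_field_def field_nonsmooth field_add field_cmult field_mult
       algebra_simps\<close>)

section \<open>The Lie bracket and its Jacobi identity\<close>

text \<open>This and the next two rules lift the pointwise laws to whole functions, so that a second
  field can be applied to the result.\<close>

lemma apply_field_add:
  "X \<in> vector_fields n \<A> \<Longrightarrow> f \<in> smooth_functions n \<A> \<Longrightarrow> g \<in> smooth_functions n \<A> \<Longrightarrow>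
    apply_field X (f + g) = apply_field X f + apply_field X g"
  by (simp add: apply_field_def fun_eq_iff field_add)

lemma apply_field_cmult:
  "X \<in> vector_fields n \<A> \<Longrightarrow> f \<in> smooth_functions n \<A> \<Longrightarrow>
    apply_field X (\<lambda>q. c * f q) = (\<lambda>q. c * apply_field X f q)"
  by (simp add: apply_field_def fun_eq_iff field_cmult)

lemma apply_field_mult:
  "X \<in> vector_fields n \<A> \<Longrightarrow> f \<in> smooth_functions n \<A> \<Longrightarrow> g \<in> smooth_functions n \<A> \<Longrightarrow>
    apply_field X (f * g) = apply_field X f * g + f * apply_field X g"
  by (simp add: apply_field_def fun_eq_iff field_mult)

text \<open>A composite of two derivations violates Leibniz by the mixed terms
  \<open>X f * Y g\<close> and \<open>Y f * X g\<close>. These are symmetric in \<open>X\<close> and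
  \<open>Y\<close>, so the commutator is again a derivation.\<close>

lemma vector_fields_jacobi_lie:
  assumes X: "X \<in> vector_fields n \<A>" and Y: "Y \<in> vector_fields n \<A>"
  shows "jacobi_lie X Y \<in> vector_fields n \<A>"
proof (rule vector_fieldsI)
  fix p f g assume fg: "f \<in> smooth_functions n \<A>" "g \<in> smooth_functions n \<A>"
  show "jacobi_lie X Y p (f * g) = jacobi_lie X Y p f * g p + f p * jacobi_lie X Y p g"
    using X Y fg
    \<comment> \<open>\<open>apply_field\<close> stays folded while the derivation rules are
      applied, since their smoothness conditions are stated for it. Unfolding it then leaves an
      identity of real numbers.\<close>
    by (simp add: jacobi_lie_def apply_field_mult field_add field_mult smooth_functions_mult
        apply_field_smooth) (simp add: apply_field_def algebra_simps)
next
  fix f assume f: "f \<in> smooth_functions n \<A>"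
  have "apply_field (jacobi_lie X Y) f
      = apply_field X (apply_field Y f) - apply_field Y (apply_field X f)"
    by (simp add: apply_field_def jacobi_lie_def fun_eq_iff)
  then show "apply_field (jacobi_lie X Y) f \<in> smooth_functions n \<A>"
    using X Y f by (simp add: smooth_functions_diff apply_field_smooth)
qed (use X Y in \<open>simp_all add: jacobi_lie_def apply_field_nonsmooth field_zero apply_field_add
       apply_field_cmult field_add field_cmult apply_field_smooth algebra_simps\<close>)

lemma jacobi_lie_jacobi:
  assumes XYZ: "X \<in> vector_fields n \<A>" "Y \<in> vector_fields n \<A>" "Z \<in> vector_fields n \<A>"
  shows "jacobi_lie X (jacobi_lie Y Z) + jacobi_lie Y (jacobi_lie Z X)
    + jacobi_lie Z (jacobi_lie X Y) = 0"
proof (intro ext)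
  fix p f
  have brk: "apply_field (jacobi_lie U V) f
      = apply_field U (apply_field V f) - apply_field V (apply_field U f)" for U V :: "'a vector_field"
    by (simp add: apply_field_def jacobi_lie_def fun_eq_iff)
  show "(jacobi_lie X (jacobi_lie Y Z) + jacobi_lie Y (jacobi_lie Z X)
    + jacobi_lie Z (jacobi_lie X Y)) p f = 0 p f"
  proof (cases "f \<in> smooth_functions n \<A>")
    case True
    then show ?thesis
      \<comment> \<open>Only brackets whose second argument is itself a bracket are unfolded at
        first. \<open>brk\<close> and \<open>field_diff\<close> then split the inner commutators,
        and the final unfolding makes the terms cancel in pairs.\<close>
      using XYZ by (simp add: jacobi_lie_def[of _ "jacobi_lie _ _"] brk field_diff
          apply_field_smooth) (simp add: jacobi_lie_def)
  next
    case False
    then show ?thesis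
      using XYZ by (simp add: field_nonsmooth[where \<A> = \<A> and n = n] vector_fields_jacobi_lie)
  qed
qed

section \<open>The connection algebra\<close>

locale connection =
  fixes n :: nat and \<A> :: "'a chart set"
    and D :: "'a vector_field \<Rightarrow> 'a vector_field \<Rightarrow> 'a vector_field"
  assumes affine: "affine_connection n \<A> D"
begin

abbreviation "VF \<equiv> vector_fields n \<A>"
abbreviation "SF \<equiv> smooth_functions n \<A>"

lemma closed: "X \<in> VF \<Longrightarrow> Y \<in> VF \<Longrightarrow> D X Y \<in> VF"
  and add_left: "X \<in> VF \<Longrightarrow> Y \<in> VF \<Longrightarrow> Z \<in> VF \<Longrightarrow> D (X + Y) Z = D X Z + D Y Z"
  and add_right: "X \<in> VF \<Longrightarrow> Y \<in> VF \<Longrightarrow> Z \<in> VF \<Longrightarrow> D X (Y + Z) = D X Y + D X Z"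
  and scale_left: "X \<in> VF \<Longrightarrow> Y \<in> VF \<Longrightarrow> f \<in> SF \<Longrightarrow> D (scale_field f X) Y = scale_field f (D X Y)"
  and scale_right: "X \<in> VF \<Longrightarrow> Y \<in> VF \<Longrightarrow> f \<in> SF \<Longrightarrow>
    D X (scale_field f Y) = scale_field (apply_field X f) Y + scale_field f (D X Y)"
  using affine by (simp_all add: affine_connection_def)

lemma diff_left:
  assumes "X \<in> VF" "Y \<in> VF" "Z \<in> VF"
  shows "D (X - Y) Z = D X Z - D Y Z"
  using add_left[of "X - Y" Y Z] assms by (simp add: vector_fields_diff)

lemma diff_right:
  assumes "X \<in> VF" "Y \<in> VF" "Z \<in> VF"
  shows "D X (Y - Z) = D X Y - D X Z"
  using add_right[of X "Y - Z" Z] assms by (simp add: vector_fields_diff)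

lemma torsion_closed: "X \<in> VF \<Longrightarrow> Y \<in> VF \<Longrightarrow> torsion D X Y \<in> VF"
  unfolding torsion_def by (intro vector_fields_diff closed vector_fields_jacobi_lie)

section \<open>Behaviour of the triple bracket under multiplication by functions\<close>

lemma triple_bracket_swap: "triple_bracket D Y X Z = - triple_bracket D X Y Z"
  by (simp add: triple_bracket_def)

text \<open>In \<open>ass D X (scale_field f Y) Z\<close> the term \<open>(X f) (D Y Z)\<close>
  arises from both summands and cancels. The associator with \<open>X\<close> and \<open>Y\<close>
  exchanged is linear in its first argument.\<close>

lemma triple_bracket_scale_middle:
  assumes "X \<in> VF" "Y \<in> VF" "Z \<in> VF" "f \<in> SF"
  shows "triple_bracket D X (scale_field f Y) Z = scale_field f (triple_bracket D X Y Z)"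
  using assms
  by (simp add: triple_bracket_def ass_def scale_left scale_right add_left closed
      vector_fields_scale apply_field_smooth)
    (simp add: scale_field_def fun_eq_iff algebra_simps)

text \<open>The mixed terms \<open>(X f) (D Y Z)\<close> and \<open>(Y f) (D X Z)\<close> cancel on
  exchanging \<open>X\<close> and \<open>Y\<close>. What remains beside the multiple by
  \<open>f\<close> is \<open>jacobi_lie X Y - (D X Y - D Y X)\<close>, applied to \<open>f\<close>
  and multiplying \<open>Z\<close>.\<close>

lemma triple_bracket_scale_right:
  assumes "X \<in> VF" "Y \<in> VF" "Z \<in> VF" "f \<in> SF"
  shows "triple_bracket D X Y (scale_field f Z)
    = scale_field f (triple_bracket D X Y Z) - scale_field (apply_field (torsion D X Y) f) Z"
  using assms
  by (simp add: triple_bracket_def ass_def scale_right add_right closed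
      vector_fields_scale apply_field_smooth)
    (simp add: torsion_def jacobi_lie_def scale_field_def apply_field_def fun_eq_iff algebra_simps)

lemma lat_algebra_torsion_free:
  assumes "lat_algebra VF D" and X: "X \<in> VF" and Y: "Y \<in> VF"
  shows "torsion D X Y = 0"
proof (intro ext)
  fix p f
  define T where "T = torsion D X Y"
  have T: "T \<in> VF"
    unfolding T_def using X Y by (rule torsion_closed)
  show "torsion D X Y p f = 0 p f"
  proof (cases "f \<in> SF")
    case True
    have cyc: "triple_bracket D X Y Z + triple_bracket D Y Z X + triple_bracket D Z X Y = 0"
      if "Z \<in> VF" for Z
      using assms that by (simp add: lat_algebra_def)
    \<comment> \<open>The swap rule is restricted to brackets with \<open>X\<close> in second place:
      it moves the scaled field of the third summand into the middle, where scaling is known. Only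
      the first summand contributes a correction.\<close>
    have "triple_bracket D X Y (scale_field f T) + triple_bracket D Y (scale_field f T) X
        + triple_bracket D (scale_field f T) X Y
      = scale_field f (triple_bracket D X Y T + triple_bracket D Y T X + triple_bracket D T X Y)
        - scale_field (apply_field T f) T"
      using X Y T True
      by (simp add: triple_bracket_scale_right triple_bracket_scale_middle
          triple_bracket_swap[of _ X] T_def[symmetric])
        (simp add: scale_field_def fun_eq_iff algebra_simps)
    \<comment> \<open>The cyclic identity at \<open>scale_field f T\<close> annihilates the left
      side, and at \<open>T\<close> the sum scaled by \<open>f\<close>.\<close>
    then have "scale_field (apply_field T f) T = 0"
      using cyc[OF T] cyc[OF vector_fields_scale[OF T True]]
      by (simp add: scale_field_def fun_eq_iff)
    \<comment> \<open>Since \<open>T\<close> is its own test field, evaluation at \<open>p\<close>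
      on the same \<open>f\<close> yields a real square.\<close>
    then have "T p f * T p f = 0"
      by (metis apply_field_def scale_field_def zero_fun_apply)
    then show ?thesis
      by (simp add: T_def)
  next
    case False
    then show ?thesis
      using field_nonsmooth[OF T] by (simp add: T_def)
  qed
qed

section \<open>The torsion-free case and the equivalence\<close>

text \<open>The bracket is the curvature expression with \<open>D X Y - D Y X\<close> in place of
  the Lie bracket, and vanishing torsion identifies the two.\<close>

lemma triple_bracket_eq_curvature:
  assumes "torsion D X Y = 0" "X \<in> VF" "Y \<in> VF" "Z \<in> VF"
  shows "triple_bracket D X Y Z = curvature D X Y Z"
proof -
  have "jacobi_lie X Y = D X Y - D Y X"
    using assms(1) by (simp add: torsion_def)
  then show ?thesis
    using assms by (simp add: curvature_def triple_bracket_def ass_def diff_left closed)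
qed

text \<open>Without torsion every Lie bracket, inner or outer, is a commutator of the product
  \<open>D\<close>. The Jacobi identity expanded this way is the cyclic sum, up to the order of its
  terms.\<close>

lemma first_Bianchi:
  assumes tf: "\<And>U V. U \<in> VF \<Longrightarrow> V \<in> VF \<Longrightarrow> torsion D U V = 0"
    and XYZ: "X \<in> VF" "Y \<in> VF" "Z \<in> VF"
  shows "triple_bracket D X Y Z + triple_bracket D Y Z X + triple_bracket D Z X Y = 0"
proof -
  have brk: "jacobi_lie U V = D U V - D V U" if "U \<in> VF" "V \<in> VF" for U V
    using tf[OF that] by (simp add: torsion_def)
  show ?thesis
    using jacobi_lie_jacobi[OF XYZ] XYZ
    by (simp add: brk closed vector_fields_diff diff_left diff_right triple_bracket_def ass_def
        algebra_simps)
qed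

lemma lat_algebra_iff_locally_symmetric: "lat_algebra VF D \<longleftrightarrow> locally_symmetric n \<A> D"
proof -
  \<comment> \<open>Torsion is assumed to vanish for all pairs, since the bracket is also replaced
    at derived fields such as \<open>D W X\<close>. The right side is the expression in the second
    LAT identity.\<close>
  have nabla: "nabla_curvature D W X Y Z = D W (triple_bracket D X Y Z) - triple_bracket D (D W X) Y Z
      - triple_bracket D X (D W Y) Z - triple_bracket D X Y (D W Z)"
    if "\<And>U V. U \<in> VF \<Longrightarrow> V \<in> VF \<Longrightarrow> torsion D U V = 0"
      "W \<in> VF" "X \<in> VF" "Y \<in> VF" "Z \<in> VF" for W X Y Z
    using that by (simp add: nabla_curvature_def triple_bracket_eq_curvature closed)
  show ?thesis
  proof
    assume lat: "lat_algebra VF D"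
    note tf = lat_algebra_torsion_free[OF lat]
    show "locally_symmetric n \<A> D"
      using lat by (simp add: locally_symmetric_def tf nabla lat_algebra_def)
  next
    assume sym: "locally_symmetric n \<A> D"
    then have tf: "torsion D U V = 0" if "U \<in> VF" "V \<in> VF" for U V
      using that by (simp add: locally_symmetric_def)
    show "lat_algebra VF D"
      using sym first_Bianchi[OF tf] by (simp add: lat_algebra_def locally_symmetric_def nabla[OF tf])
  qed
qed

end

theorem proposition2p3:
  fixes n :: nat
    and \<A> :: "'a::{t2_space,second_countable_topology} chart set"
    and D :: "'a vector_field \<Rightarrow> 'a vector_field \<Rightarrow> 'a vector_field"
  assumes "smooth_manifold n \<A>"
    and "affine_connection n \<A> D"
  shows "lat_algebra (vector_fields n \<A>) D \<longleftrightarrow> locally_symmetric n \<A> D"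
proof -
  interpret connection n \<A> D
    using assms(2) by unfold_locales
  show ?thesis
    by (rule lat_algebra_iff_locally_symmetric)
qed

end
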